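(* (1) Let $q_i=a_i\alpha^2+2b_i\alpha\beta+c_i\beta^2$, $i=1,2$, be two real binary quadratic forms and consider the quotient $$f(\alpha,\beta)=\frac{q_2(\alpha,\beta)}{q_1(\alpha,\beta)},$$ defined off the set $q_1(\alpha,\beta)=0$. There are two local (global if $q_1$ is positive definite) extremal sets of points of the function $f$, which lie along the rays $(t\alpha,t\beta)$ where $(\alpha,\beta)$ are solutions of the quadratic equation $$\mathrm{Jac}(q_1,q_2):=\begin{vmatrix}\beta^2&-\alpha\beta&\alpha^2\\ a_1&b_1&c_1\\ a_2&b_2&c_2\end{vmatrix}=0 .$$ The form $\mathrm{Jac}(q_1,q_2)$ is, up to the constant factor $4$, the determinant of the $2\times2$ matrix of partial derivatives of $q_1,q_2$ with respect to $\alpha,\beta$. The two directions coincide if and only if $q_1$ and $q_2$ have a common root. (2) Represent $q_i$ by the symmetric matrix $E_i=\begin{pmatrix}a_i&b_i\\ b_i&c_i\end{pmatrix}$ and write $w=(\alpha,\beta)^T$. The directions in (1) are the solutions $w$ of $E_2w=\mu E_1w$. The corresponding values of $\mu$, denoted $\mu_1,\mu_2$, are real if $E_1$ is positive or negative definite. (3) The directions $(\alpha_1,\beta_1),(\alpha_2,\beta_2)$ corresponding to $\mu_1,\mu_2$ are orthogonal with respect to $q_2$. With respect to the same form $q_2$ they bisect the directions given by $q_1=0$ when these are real; this only occurs when $q_2$ is positive definite.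
   Context: A root of a binary quadratic form $q$ is a direction $(\alpha:\beta)$ (possibly complex, counted with multiplicity) with $q(\alpha,\beta)=0$. Since $f$ is homogeneous of degree $0$, it is a function of the direction $(\alpha:\beta)$, and its extremal points are those of the function of one variable obtained in an affine chart (e.g. $\beta=1$). Two directions $w_1,w_2$ are orthogonal with respect to a quadratic form with symmetric matrix $E$ if $w_1^TEw_2=0$.
   Formalization: Jac is assumed not identically zero when its two roots are used; two distinct extremal directions are claimed only if q1, q2 have no common root and det E1≠0 (non-real ones are stationary); a Jac root w solves E2w=μE1w only if E1w≠0. Without these the claims fail, e.g. q1=β², q2=α²+β². *)

theory Defs
  imports "HOL-Analysis.Analysis"
begin

text \<open>A real binary quadratic form \<open>a \<alpha>\<^sup>2 + 2 b \<alpha> \<beta> + c \<beta>\<^sup>2\<close>, given by its coefficients. The forms, their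
  matrices and the Jacobian are evaluated on vectors over any real normed field, so that the same
  constants serve for real directions (\<open>real ^ 2\<close>) and for complex ones (\<open>complex ^ 2\<close>);
  over the reals \<open>of_real\<close> is the identity.\<close>

datatype bqf = BQF (ca: real) (cb: real) (cc: real)

definition qf :: "bqf \<Rightarrow> 'a::real_normed_field ^ 2 \<Rightarrow> 'a" where
  "qf q w = of_real (ca q) * (w $ 1)\<^sup>2 + 2 * of_real (cb q) * w $ 1 * w $ 2
            + of_real (cc q) * (w $ 2)\<^sup>2"

definition qmat :: "bqf \<Rightarrow> 'a::real_normed_field ^ 2 ^ 2" where
  "qmat q = vector [vector [of_real (ca q), of_real (cb q)],
                    vector [of_real (cb q), of_real (cc q)]]"

definition Jac :: "bqf \<Rightarrow> bqf \<Rightarrow> 'a::real_normed_field ^ 2 \<Rightarrow> 'a" where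
  "Jac q1 q2 w = det (vector
     [vector [(w $ 2)\<^sup>2, - (w $ 1 * w $ 2), (w $ 1)\<^sup>2],
      vector [of_real (ca q1), of_real (cb q1), of_real (cc q1)],
      vector [of_real (ca q2), of_real (cb q2), of_real (cc q2)]] :: 'a ^ 3 ^ 3)"

text \<open>\<open>u\<^sup>T E v\<close>, without complex conjugation.\<close>

definition bilin :: "'a::real_normed_field ^ 2 ^ 2 \<Rightarrow> 'a ^ 2 \<Rightarrow> 'a ^ 2 \<Rightarrow> 'a" where
  "bilin E u v = (\<Sum>i\<in>UNIV. u $ i * (E *v v) $ i)"

definition orthogonal_wrt :: "'a::real_normed_field ^ 2 ^ 2 \<Rightarrow> 'a ^ 2 \<Rightarrow> 'a ^ 2 \<Rightarrow> bool" where
  "orthogonal_wrt E u v \<longleftrightarrow> bilin E u v = 0"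

definition pos_def :: "bqf \<Rightarrow> bool" where
  "pos_def q \<longleftrightarrow> (\<forall>w :: real ^ 2. w \<noteq> 0 \<longrightarrow> 0 < qf q w)"

definition pos_def_matrix :: "real ^ 2 ^ 2 \<Rightarrow> bool" where
  "pos_def_matrix E \<longleftrightarrow> transpose E = E \<and> (\<forall>w. w \<noteq> 0 \<longrightarrow> 0 < bilin E w w)"

definition neg_def_matrix :: "real ^ 2 ^ 2 \<Rightarrow> bool" where
  "neg_def_matrix E \<longleftrightarrow> transpose E = E \<and> (\<forall>w. w \<noteq> 0 \<longrightarrow> bilin E w w < 0)"

text \<open>Nonzero vectors representing the same direction \<open>(\<alpha> : \<beta>)\<close>.\<close>

definition same_direction :: "'a::real_normed_field ^ 2 \<Rightarrow> 'a ^ 2 \<Rightarrow> bool" where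
  "same_direction u v \<longleftrightarrow> (\<exists>c. c \<noteq> 0 \<and> u = c *s v)"

text \<open>The directions of \<open>w1\<close>, \<open>w2\<close> are the two roots, counted with multiplicity, of the form \<open>Q\<close>
  (which is then not identically zero): the linear form with root \<open>w\<close> is \<open>v \<mapsto> det [w, v]\<close>.\<close>

definition roots_of :: "('a::real_normed_field ^ 2 \<Rightarrow> 'a) \<Rightarrow> 'a ^ 2 \<Rightarrow> 'a ^ 2 \<Rightarrow> bool" where
  "roots_of Q w1 w2 \<longleftrightarrow> w1 \<noteq> 0 \<and> w2 \<noteq> 0 \<and>
     (\<exists>k. k \<noteq> 0 \<and>
        (\<forall>v. Q v = k * det (vector [w1, v] :: 'a ^ 2 ^ 2) * det (vector [w2, v] :: 'a ^ 2 ^ 2)))"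

definition common_root :: "bqf \<Rightarrow> bqf \<Rightarrow> bool" where
  "common_root q1 q2 \<longleftrightarrow> (\<exists>w :: complex ^ 2. w \<noteq> 0 \<and> qf q1 w = 0 \<and> qf q2 w = 0)"

text \<open>The quotient \<open>f = q\<^sub>2 / q\<^sub>1\<close>; it is only meaningful where \<open>q\<^sub>1\<close> does not vanish, and the
  predicates below include this condition.\<close>

definition quot :: "bqf \<Rightarrow> bqf \<Rightarrow> 'a::real_normed_field ^ 2 \<Rightarrow> 'a" where
  "quot q1 q2 w = qf q2 w / qf q1 w"

definition local_extremum :: "(real \<Rightarrow> real) \<Rightarrow> real \<Rightarrow> bool" where
  "local_extremum g t0 \<longleftrightarrow>
     (\<forall>\<^sub>F t in nhds t0. g t \<le> g t0) \<or> (\<forall>\<^sub>F t in nhds t0. g t0 \<le> g t)"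

text \<open>Extremal and stationary directions of \<open>f\<close>, read off in the charts \<open>\<beta> = 1\<close> and \<open>\<alpha> = 1\<close>
  (each one where it contains the direction). Complex directions are covered by the second notion.
  There is no need to restrict the neighbourhoods to the domain of \<open>f\<close>, which is open.\<close>

definition local_extremal :: "bqf \<Rightarrow> bqf \<Rightarrow> real ^ 2 \<Rightarrow> bool" where
  "local_extremal q1 q2 w \<longleftrightarrow> qf q1 w \<noteq> 0 \<and>
     (w $ 2 \<noteq> 0 \<longrightarrow> local_extremum (\<lambda>t. quot q1 q2 (vector [t, 1])) (w $ 1 / w $ 2)) \<and>
     (w $ 1 \<noteq> 0 \<longrightarrow> local_extremum (\<lambda>s. quot q1 q2 (vector [1, s])) (w $ 2 / w $ 1))"

definition stationary :: "bqf \<Rightarrow> bqf \<Rightarrow> 'a::real_normed_field ^ 2 \<Rightarrow> bool" where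
  "stationary q1 q2 w \<longleftrightarrow> qf q1 w \<noteq> 0 \<and>
     (w $ 2 \<noteq> 0 \<longrightarrow>
        ((\<lambda>t. quot q1 q2 (vector [t, 1])) has_field_derivative 0) (at (w $ 1 / w $ 2))) \<and>
     (w $ 1 \<noteq> 0 \<longrightarrow>
        ((\<lambda>s. quot q1 q2 (vector [1, s])) has_field_derivative 0) (at (w $ 2 / w $ 1)))"

definition global_min :: "bqf \<Rightarrow> bqf \<Rightarrow> real ^ 2 \<Rightarrow> bool" where
  "global_min q1 q2 w \<longleftrightarrow> qf q1 w \<noteq> 0 \<and> (\<forall>v. qf q1 v \<noteq> 0 \<longrightarrow> quot q1 q2 w \<le> quot q1 q2 v)"

definition global_max :: "bqf \<Rightarrow> bqf \<Rightarrow> real ^ 2 \<Rightarrow> bool" where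
  "global_max q1 q2 w \<longleftrightarrow> qf q1 w \<noteq> 0 \<and> (\<forall>v. qf q1 v \<noteq> 0 \<longrightarrow> quot q1 q2 v \<le> quot q1 q2 w)"

text \<open>The angle in \<open>[0, \<pi>/2]\<close> between the lines spanned by \<open>u\<close> and \<open>v\<close>, measured with \<open>E\<close>. It is
  defined when \<open>u\<close> and \<open>v\<close> have positive \<open>E\<close>-length; \<open>E\<close> itself need not be positive definite.\<close>

definition angle_wrt :: "real ^ 2 ^ 2 \<Rightarrow> real ^ 2 \<Rightarrow> real ^ 2 \<Rightarrow> real" where
  "angle_wrt E u v = arccos (\<bar>bilin E u v\<bar> / (sqrt (bilin E u u) * sqrt (bilin E v v)))"

definition bisects :: "real ^ 2 ^ 2 \<Rightarrow> real ^ 2 \<Rightarrow> real ^ 2 \<Rightarrow> real ^ 2 \<Rightarrow> bool" where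
  "bisects E w u1 u2 \<longleftrightarrow>
     0 < bilin E w w \<and> 0 < bilin E u1 u1 \<and> 0 < bilin E u2 u2 \<and>
     angle_wrt E u1 w = angle_wrt E w u2"

end

theory Submission
  imports Defs
begin

text \<open>
  Everything rests on the identity \<open>Jac w = det [E\<^sub>1 w, E\<^sub>2 w]\<close>. It makes the roots of the Jacobian,
  apart from kernel vectors of \<open>E\<^sub>1\<close>, the directions with \<open>E\<^sub>2 w = \<mu> E\<^sub>1 w\<close>, and in an affine
  chart it is, up to a factor \<open>\<plusminus>2\<close>,
  the numerator of the derivative of \<open>f\<close>. Two consequences carry the rest.

  The first is about a single root \<open>w\<close> with \<open>q\<^sub>1 w \<noteq> 0\<close>. Since \<open>w\<close> spans the kernel of
  \<open>E\<^sub>2 - \<mu> E\<^sub>1\<close> or that matrix is zero, \<open>q\<^sub>2 - \<mu> q\<^sub>1\<close> is a multiple of the square of the linear form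
  vanishing at \<open>w\<close> (\<open>rank_one_remainder\<close>). Hence \<open>f - \<mu>\<close> has a constant sign near \<open>w\<close>, and
  everywhere if \<open>q\<^sub>1\<close> is positive definite: every stationary direction is extremal, and every one is
  globally so over a positive definite denominator.

  The second is about the pair of roots \<open>w\<^sub>1, w\<^sub>2\<close>. The coefficients of the Jacobian form the cross
  product of those of \<open>q\<^sub>1\<close> and \<open>q\<^sub>2\<close>, so the Jacobian is apolar to both forms, which means that
  \<open>w\<^sub>1\<close> and \<open>w\<^sub>2\<close> are conjugate for both (\<open>Jac_roots_conjugate\<close>). This is the orthogonality. If
  the roots coincide, it says that the double root is a common root of \<open>q\<^sub>1\<close> and \<open>q\<^sub>2\<close>; conversely a
  common root makes the cross product the coefficient vector of a square
  (\<open>Jac_at_common_root\<close>). Apolarity to a definite form also makes the discriminant of the Jacobian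
  nonnegative, whence real roots.

  For the bisectors, the difference of the two squared cosines is, up to positive denominators, a
  multiple of the Jacobian (\<open>bisector_identity\<close>). In the other direction, being bisectors gives
  both directions positive length, and an orthogonal basis of vectors of positive length makes
  \<open>q\<^sub>2\<close> positive definite.
\<close>

section \<open>Coordinates\<close>

text \<open>The indices are the exponents of \<open>\<alpha>\<close> and \<open>\<beta>\<close>: these minors are the coefficients of the
  Jacobian. They are real even when the Jacobian is evaluated on complex vectors.\<close>

definition jac20 :: "bqf \<Rightarrow> bqf \<Rightarrow> real" where
  "jac20 q1 q2 = ca q1 * cb q2 - ca q2 * cb q1"

definition jac11 :: "bqf \<Rightarrow> bqf \<Rightarrow> real" where
  "jac11 q1 q2 = ca q1 * cc q2 - ca q2 * cc q1"

definition jac02 :: "bqf \<Rightarrow> bqf \<Rightarrow> real" where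
  "jac02 q1 q2 = cb q1 * cc q2 - cb q2 * cc q1"

lemmas jac_coeff_defs = jac20_def jac11_def jac02_def

lemma det_pair:
  fixes u v :: "'a::real_normed_field ^ 2"
  shows "det (vector [u, v] :: 'a ^ 2 ^ 2) = u $ 1 * v $ 2 - u $ 2 * v $ 1"
  by (simp add: det_2)

lemma vec2_eq_0_iff: "w = 0 \<longleftrightarrow> w $ 1 = 0 \<and> w $ 2 = 0" for w :: "'a::zero ^ 2"
  by (simp add: vec_eq_iff forall_2)

lemma Jac_eq:
  fixes w :: "'a::real_normed_field ^ 2"
  shows "Jac q1 q2 w = of_real (jac20 q1 q2) * (w $ 1)\<^sup>2
           + of_real (jac11 q1 q2) * w $ 1 * w $ 2 + of_real (jac02 q1 q2) * (w $ 2)\<^sup>2"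
  by (simp add: Jac_def det_3 jac_coeff_defs algebra_simps)

lemma qmat_mult:
  fixes v :: "'a::real_normed_field ^ 2"
  shows "(qmat q *v v) $ 1 = of_real (ca q) * v $ 1 + of_real (cb q) * v $ 2"
    and "(qmat q *v v) $ 2 = of_real (cb q) * v $ 1 + of_real (cc q) * v $ 2"
  by (simp_all add: qmat_def matrix_vector_mult_def sum_2)

lemma bilin_qmat:
  fixes u v :: "'a::real_normed_field ^ 2"
  shows "bilin (qmat q) u v = of_real (ca q) * u $ 1 * v $ 1
           + of_real (cb q) * (u $ 1 * v $ 2 + u $ 2 * v $ 1) + of_real (cc q) * u $ 2 * v $ 2"
  by (simp add: bilin_def sum_2 qmat_mult algebra_simps)

lemma qf_eq_bilin: "qf q w = bilin (qmat q) w w"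
  by (simp add: qf_def bilin_qmat power2_eq_square algebra_simps)

text \<open>By Euler's relation the gradient of \<open>q\<close> at \<open>w\<close> is \<open>2 E w\<close>, so this is the gradient
  determinant without its factor 4. It turns the vanishing of the Jacobian into the parallelism
  of \<open>E\<^sub>1 w\<close> and \<open>E\<^sub>2 w\<close>.\<close>

lemma Jac_eq_det_images:
  fixes w :: "'a::real_normed_field ^ 2"
  shows "Jac q1 q2 w = (qmat q1 *v w) $ 1 * (qmat q2 *v w) $ 2
           - (qmat q1 *v w) $ 2 * (qmat q2 *v w) $ 1"
  by (simp add: Jac_eq qmat_mult jac_coeff_defs power2_eq_square algebra_simps)

lemma gradient_det:
  "det (vector
      [vector [deriv (\<lambda>x. qf q1 (vector [x, \<beta>])) \<alpha>, deriv (\<lambda>y. qf q1 (vector [\<alpha>, y])) \<beta>],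
       vector [deriv (\<lambda>x. qf q2 (vector [x, \<beta>])) \<alpha>, deriv (\<lambda>y. qf q2 (vector [\<alpha>, y])) \<beta>]]
      :: real ^ 2 ^ 2) = 4 * Jac q1 q2 (vector [\<alpha>, \<beta>])"
proof -
  have "deriv (\<lambda>x. qf q (vector [x, \<beta>])) \<alpha> = 2 * (qmat q *v vector [\<alpha>, \<beta>]) $ 1"
    "deriv (\<lambda>y. qf q (vector [\<alpha>, y])) \<beta> = 2 * (qmat q *v vector [\<alpha>, \<beta>]) $ 2" for q
    unfolding qf_def vector_2
    by (rule DERIV_imp_deriv; auto intro!: derivative_eq_intros simp: qmat_mult)+
  then show ?thesis by (simp add: det_2 Jac_eq_det_images)
qed

lemma qf_scale: "qf q (c *s w) = c\<^sup>2 * qf q w"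
  by (simp add: qf_def power2_eq_square algebra_simps)

lemma Jac_scale: "Jac q1 q2 (c *s w) = c\<^sup>2 * Jac q1 q2 w"
  by (simp add: Jac_eq power2_eq_square algebra_simps)

lemma quot_scale: "c \<noteq> 0 \<Longrightarrow> quot q1 q2 (c *s w) = quot q1 q2 w"
  by (simp add: quot_def qf_scale)

lemma chart_2: "w $ 2 \<noteq> 0 \<Longrightarrow> w = w $ 2 *s vector [w $ 1 / w $ 2, 1]"
  and chart_1: "w $ 1 \<noteq> 0 \<Longrightarrow> w = w $ 1 *s vector [1, w $ 2 / w $ 1]"
  for w :: "'a::real_normed_field ^ 2"
  by (simp_all add: vec_eq_iff forall_2)

lemma qf_zero [simp]: "qf q 0 = 0"
  by (simp add: qf_def)

section \<open>Roots of binary quadratic forms\<close>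

lemma same_direction_iff_det:
  fixes u v :: "'a::real_normed_field ^ 2"
  assumes "u \<noteq> 0" "v \<noteq> 0"
  shows "same_direction u v \<longleftrightarrow> u $ 1 * v $ 2 - u $ 2 * v $ 1 = 0"
proof
  assume "same_direction u v"
  then show "u $ 1 * v $ 2 - u $ 2 * v $ 1 = 0"
    by (auto simp: same_direction_def)
next
  assume det: "u $ 1 * v $ 2 - u $ 2 * v $ 1 = 0"
  show "same_direction u v"
  proof (cases "v $ 1 = 0")
    case True
    with assms det have v2: "v $ 2 \<noteq> 0" and u1: "u $ 1 = 0"
      by (auto simp: vec2_eq_0_iff)
    with assms have "u $ 2 \<noteq> 0" by (auto simp: vec2_eq_0_iff)
    with True v2 u1 show ?thesis
      unfolding same_direction_def
      by (intro exI[of _ "u $ 2 / v $ 2"]) (auto simp: vec_eq_iff forall_2)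
  next
    case False
    with assms det have "u $ 1 \<noteq> 0" by (auto simp: vec2_eq_0_iff)
    with False det show ?thesis
      unfolding same_direction_def
      by (intro exI[of _ "u $ 1 / v $ 1"]) (auto simp: vec_eq_iff forall_2 field_simps)
  qed
qed

lemma roots_of_zero_iff:
  fixes w :: "'a::real_normed_field ^ 2"
  assumes "roots_of Q w1 w2" "w \<noteq> 0"
  shows "Q w = 0 \<longleftrightarrow> same_direction w w1 \<or> same_direction w w2"
proof -
  from assms(1) obtain k where k: "k \<noteq> 0" "w1 \<noteq> 0" "w2 \<noteq> 0"
    and Q: "\<And>v. Q v = k * (w1 $ 1 * v $ 2 - w1 $ 2 * v $ 1) * (w2 $ 1 * v $ 2 - w2 $ 2 * v $ 1)"
    unfolding roots_of_def det_pair by blast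
  have anti: "x $ 1 * w $ 2 - x $ 2 * w $ 1 = - (w $ 1 * x $ 2 - w $ 2 * x $ 1)" for x
    by (simp add: mult.commute)
  from k(1) show ?thesis
    by (simp only: Q anti mult_eq_0_iff neg_equal_0_iff_equal simp_thms
        same_direction_iff_det[OF assms(2) k(2)] same_direction_iff_det[OF assms(2) k(3)])
qed

lemma roots_of_vanish: "roots_of Q w1 w2 \<Longrightarrow> Q w1 = 0 \<and> Q w2 = 0"
  by (auto simp: roots_of_def det_pair)

lemma roots_of_sym: "roots_of Q w1 w2 \<Longrightarrow> roots_of Q w2 w1"
  by (simp add: roots_of_def ac_simps)

lemma roots_of_nonzero: "roots_of Q w1 w2 \<Longrightarrow> w1 \<noteq> 0 \<and> w2 \<noteq> 0"
  by (simp add: roots_of_def)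

lemma roots_of_coeffs:
  fixes A B C :: "'a::real_normed_field"
  assumes "roots_of Q w1 w2"
    and Q: "\<And>v. Q v = A * (v $ 1)\<^sup>2 + B * v $ 1 * v $ 2 + C * (v $ 2)\<^sup>2"
  obtains k where "k \<noteq> 0" "A = k * w1 $ 2 * w2 $ 2"
    "B = - k * (w1 $ 1 * w2 $ 2 + w1 $ 2 * w2 $ 1)" "C = k * w1 $ 1 * w2 $ 1"
proof -
  from assms(1) obtain k where k: "k \<noteq> 0"
    and R: "\<And>v. Q v = k * (w1 $ 1 * v $ 2 - w1 $ 2 * v $ 1) * (w2 $ 1 * v $ 2 - w2 $ 2 * v $ 1)"
    unfolding roots_of_def det_pair by blast
  have A: "A = k * w1 $ 2 * w2 $ 2" using Q[of "vector [1, 0]"] R[of "vector [1, 0]"] by simp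
  have C: "C = k * w1 $ 1 * w2 $ 1" using Q[of "vector [0, 1]"] R[of "vector [0, 1]"] by simp
  have "A + B + C = k * (w1 $ 1 - w1 $ 2) * (w2 $ 1 - w2 $ 2)"
    using Q[of "vector [1, 1]"] R[of "vector [1, 1]"] by simp
  with A C have "B = - k * (w1 $ 1 * w2 $ 2 + w1 $ 2 * w2 $ 1)" by algebra
  with k A C that show ?thesis by blast
qed

text \<open>The quadratic formula in homogeneous form. The root at infinity is the case \<open>A = 0\<close>.\<close>

lemma roots_of_exist:
  fixes A B C s :: "'a::real_normed_field"
  assumes s: "s\<^sup>2 = B\<^sup>2 - 4 * A * C" and nz: "A \<noteq> 0 \<or> B \<noteq> 0 \<or> C \<noteq> 0"
    and Q: "\<And>v. Q v = A * (v $ 1)\<^sup>2 + B * v $ 1 * v $ 2 + C * (v $ 2)\<^sup>2"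
  shows "\<exists>w1 w2. roots_of Q w1 w2"
proof (cases "A = 0")
  case True
  with nz have "roots_of Q (vector [1, 0]) (vector [C, - B])"
    unfolding roots_of_def det_pair
    by (auto simp: vec2_eq_0_iff Q power2_eq_square algebra_simps intro!: exI[of _ 1])
  then show ?thesis by blast
next
  case False
  have "Q v = 1 / (4 * A) * ((- B + s) * v $ 2 - 2 * A * v $ 1) * ((- B - s) * v $ 2 - 2 * A * v $ 1)"
    for v
  proof -
    have "((- B + s) * v $ 2 - 2 * A * v $ 1) * ((- B - s) * v $ 2 - 2 * A * v $ 1)
        = 4 * A\<^sup>2 * (v $ 1)\<^sup>2 + 4 * A * B * v $ 1 * v $ 2 + (B\<^sup>2 - s\<^sup>2) * (v $ 2)\<^sup>2"
      by (simp add: power2_eq_square algebra_simps)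
    also have "\<dots> = 4 * A * Q v"
      unfolding s Q by (simp add: power2_eq_square algebra_simps)
    finally show ?thesis using False by (simp add: field_simps)
  qed
  with False have "roots_of Q (vector [- B + s, 2 * A]) (vector [- B - s, 2 * A])"
    unfolding roots_of_def det_pair
    by (auto simp: vec2_eq_0_iff intro!: exI[of _ "1 / (4 * A)"])
  then show ?thesis by blast
qed

lemma Jac_nonzero_iff:
  "(\<exists>v :: real ^ 2. Jac q1 q2 v \<noteq> 0)
     \<longleftrightarrow> jac20 q1 q2 \<noteq> 0 \<or> jac11 q1 q2 \<noteq> 0 \<or> jac02 q1 q2 \<noteq> 0"
proof
  assume "\<exists>v :: real ^ 2. Jac q1 q2 v \<noteq> 0"
  then show "jac20 q1 q2 \<noteq> 0 \<or> jac11 q1 q2 \<noteq> 0 \<or> jac02 q1 q2 \<noteq> 0"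
    by (auto simp: Jac_eq)
next
  assume R: "jac20 q1 q2 \<noteq> 0 \<or> jac11 q1 q2 \<noteq> 0 \<or> jac02 q1 q2 \<noteq> 0"
  show "\<exists>v :: real ^ 2. Jac q1 q2 v \<noteq> 0"
  proof (rule ccontr)
    assume "\<not> ?thesis"
    then have z: "Jac q1 q2 v = 0" for v :: "real ^ 2" by blast
    from z[of "vector [1, 0]"] z[of "vector [0, 1]"] z[of "vector [1, 1]"] R show False
      by (simp add: Jac_eq)
  qed
qed

lemma Jac_complex_roots:
  assumes "\<exists>v :: real ^ 2. Jac q1 q2 v \<noteq> 0"
  shows "\<exists>w1 w2 :: complex ^ 2. roots_of (Jac q1 q2) w1 w2"
  using assms unfolding Jac_nonzero_iff
  by (intro roots_of_exist[where s = "csqrt ((of_real (jac11 q1 q2))\<^sup>2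
        - 4 * of_real (jac20 q1 q2) * of_real (jac02 q1 q2))"]) (auto intro: Jac_eq)

lemma qf_complex_root: "\<exists>w :: complex ^ 2. w \<noteq> 0 \<and> qf q w = 0"
proof (cases "ca q = 0 \<and> cb q = 0 \<and> cc q = 0")
  case True
  then show ?thesis by (intro exI[of _ "vector [1, 0]"]) (simp add: qf_def vec2_eq_0_iff)
next
  case False
  have "\<exists>w1 w2 :: complex ^ 2. roots_of (qf q) w1 w2"
    using False
    by (intro roots_of_exist[where A = "of_real (ca q)" and B = "2 * of_real (cb q)"
          and C = "of_real (cc q)" and s = "csqrt ((2 * of_real (cb q))\<^sup>2
            - 4 * of_real (ca q) * of_real (cc q))"]) (auto simp: qf_def)
  then obtain w1 w2 :: "complex ^ 2" where r: "roots_of (qf q) w1 w2" by blast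
  then show ?thesis using roots_of_nonzero roots_of_vanish by blast
qed

section \<open>Apolarity and common roots\<close>

text \<open>The coefficient vector of the Jacobian is a cross product of those of \<open>q\<^sub>1\<close> and \<open>q\<^sub>2\<close>, hence
  annihilated by both; written through the roots, this annihilation says that the roots are
  conjugate for both forms.\<close>

lemma Jac_roots_conjugate:
  fixes w1 w2 :: "'a::real_normed_field ^ 2"
  assumes "roots_of (Jac q1 q2) w1 w2"
  shows "bilin (qmat q1) w1 w2 = 0" and "bilin (qmat q2) w1 w2 = 0"
proof -
  obtain k where k: "k \<noteq> 0"
    and A: "of_real (jac20 q1 q2) = k * w1 $ 2 * w2 $ 2"
    and B: "of_real (jac11 q1 q2) = - k * (w1 $ 1 * w2 $ 2 + w1 $ 2 * w2 $ 1)"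
    and C: "of_real (jac02 q1 q2) = k * w1 $ 1 * w2 $ 1"
    using roots_of_coeffs[OF assms Jac_eq] by metis
  have conj: "bilin (qmat q) w1 w2 = 0"
    if ap: "ca q * jac02 q1 q2 - cb q * jac11 q1 q2 + cc q * jac20 q1 q2 = 0" for q
  proof -
    have "k * bilin (qmat q) w1 w2 = of_real (ca q) * of_real (jac02 q1 q2)
        - of_real (cb q) * of_real (jac11 q1 q2) + of_real (cc q) * of_real (jac20 q1 q2)"
      unfolding A B C bilin_qmat by (simp add: algebra_simps)
    also have "\<dots> = of_real (ca q * jac02 q1 q2 - cb q * jac11 q1 q2 + cc q * jac20 q1 q2)"
      by simp
    also have "\<dots> = 0" by (simp only: ap of_real_0)
    finally show ?thesis using k by simp
  qed
  show "bilin (qmat q1) w1 w2 = 0" "bilin (qmat q2) w1 w2 = 0"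
    by (rule conj; simp add: jac_coeff_defs algebra_simps)+
qed

text \<open>For \<open>w\<^sub>1 = c w\<^sub>2\<close> conjugacy reads \<open>c q(w\<^sub>2) = 0\<close>.\<close>

lemma double_Jac_root_is_common_root:
  fixes w1 w2 :: "'a::real_normed_field ^ 2"
  assumes r: "roots_of (Jac q1 q2) w1 w2" and s: "same_direction w1 w2"
  shows "qf q1 w2 = 0" and "qf q2 w2 = 0"
proof -
  from s obtain c where c: "c \<noteq> 0" "w1 = c *s w2" by (auto simp: same_direction_def)
  have "bilin (qmat q) w1 w2 = c * qf q w2" for q
    by (simp add: c qf_eq_bilin bilin_qmat algebra_simps)
  with Jac_roots_conjugate[OF r] c(1) show "qf q1 w2 = 0" "qf q2 w2 = 0" by auto
qed

text \<open>At a common root \<open>w = (x, y)\<close> both coefficient vectors are orthogonal to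
  \<open>(x\<^sup>2, 2xy, y\<^sup>2)\<close>, so their cross product is a multiple of it.\<close>

lemma Jac_at_common_root:
  fixes w :: "'a::real_normed_field ^ 2"
  assumes w: "w \<noteq> 0" and q1: "qf q1 w = 0" and q2: "qf q2 w = 0"
  obtains \<kappa> where "\<And>v. Jac q1 q2 v = \<kappa> * (w $ 1 * v $ 2 - w $ 2 * v $ 1)\<^sup>2"
proof (cases "w $ 2 = 0")
  case True
  with w have x: "w $ 1 \<noteq> 0" by (simp add: vec2_eq_0_iff)
  with True q1 q2 have "ca q1 = 0" "ca q2 = 0" by (simp_all add: qf_def)
  with True x show ?thesis
    by (intro that[of "of_real (jac02 q1 q2) / (w $ 1)\<^sup>2"])
       (simp add: Jac_eq jac_coeff_defs power2_eq_square)
next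
  case False
  define x y where "x = w $ 1" and "y = w $ 2"
  define a1 b1 c1 a2 b2 c2 :: 'a where "a1 = of_real (ca q1)" and "b1 = of_real (cb q1)"
    and "c1 = of_real (cc q1)" and "a2 = of_real (ca q2)" and "b2 = of_real (cb q2)"
    and "c2 = of_real (cc q2)"
  note d = a1_def b1_def c1_def a2_def b2_def c2_def
  have y: "y \<noteq> 0" using False by (simp add: y_def)
  have e1: "a1 * x\<^sup>2 + 2 * b1 * x * y + c1 * y\<^sup>2 = 0"
    using q1 by (simp add: qf_def d x_def y_def)
  have e2: "a2 * x\<^sup>2 + 2 * b2 * x * y + c2 * y\<^sup>2 = 0"
    using q2 by (simp add: qf_def d x_def y_def)
  have "y * ((a1 * c2 - a2 * c1) * y + 2 * (a1 * b2 - a2 * b1) * x) = 0"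
    using e1 e2 by algebra
  with y have B: "(a1 * c2 - a2 * c1) * y = - 2 * (a1 * b2 - a2 * b1) * x"
    by algebra
  have C: "(b1 * c2 - b2 * c1) * y\<^sup>2 = (a1 * b2 - a2 * b1) * x\<^sup>2"
    using e1 e2 by algebra
  have "Jac q1 q2 v = (a1 * b2 - a2 * b1) / y\<^sup>2 * (x * v $ 2 - y * v $ 1)\<^sup>2" for v
  proof -
    have "y\<^sup>2 * Jac q1 q2 v = (a1 * b2 - a2 * b1) * (x * v $ 2 - y * v $ 1)\<^sup>2"
    proof -
      have "Jac q1 q2 v = (a1 * b2 - a2 * b1) * (v $ 1)\<^sup>2
          + (a1 * c2 - a2 * c1) * v $ 1 * v $ 2 + (b1 * c2 - b2 * c1) * (v $ 2)\<^sup>2"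
        by (simp add: Jac_eq jac_coeff_defs d)
      with B C show ?thesis by algebra
    qed
    with y show ?thesis by (simp add: field_simps)
  qed
  then show ?thesis using that unfolding x_def y_def by blast
qed

text \<open>The Jacobian is a nonzero multiple of the square of one linear form, so both of its roots are
  the root of that form.\<close>

lemma common_root_imp_double_Jac_root:
  fixes w w1 w2 :: "'a::real_normed_field ^ 2"
  assumes r: "roots_of (Jac q1 q2) w1 w2"
    and w: "w \<noteq> 0" "qf q1 w = 0" "qf q2 w = 0"
  shows "same_direction w1 w2"
proof -
  obtain \<kappa> where \<kappa>: "\<And>v. Jac q1 q2 v = \<kappa> * (w $ 1 * v $ 2 - w $ 2 * v $ 1)\<^sup>2"
    using Jac_at_common_root[OF w] by blast
  have nz: "w1 \<noteq> 0" "w2 \<noteq> 0" using roots_of_nonzero[OF r] by auto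
  have J: "Jac q1 q2 w1 = 0" "Jac q1 q2 w2 = 0" using roots_of_vanish[OF r] by auto
  have "\<kappa> \<noteq> 0"
  proof
    assume "\<kappa> = 0"
    then have z: "Jac q1 q2 v = 0 * (v $ 1)\<^sup>2 + 0 * v $ 1 * v $ 2 + 0 * (v $ 2)\<^sup>2" for v :: "'a ^ 2"
      by (simp add: \<kappa>)
    obtain k where "k \<noteq> 0" "0 = k * w1 $ 2 * w2 $ 2"
      "0 = - k * (w1 $ 1 * w2 $ 2 + w1 $ 2 * w2 $ 1)" "0 = k * w1 $ 1 * w2 $ 1"
      using roots_of_coeffs[OF r z] by metis
    with nz show False by (auto simp: vec2_eq_0_iff)
  qed
  with J have d: "w $ 1 * w1 $ 2 - w $ 2 * w1 $ 1 = 0" "w $ 1 * w2 $ 2 - w $ 2 * w2 $ 1 = 0"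
    by (simp_all add: \<kappa>)
  have "w $ 1 * (w1 $ 1 * w2 $ 2 - w1 $ 2 * w2 $ 1) = 0"
    "w $ 2 * (w1 $ 1 * w2 $ 2 - w1 $ 2 * w2 $ 1) = 0"
    using d by algebra+
  with w(1) have "w1 $ 1 * w2 $ 2 - w1 $ 2 * w2 $ 1 = 0" by (auto simp: vec2_eq_0_iff)
  with nz show ?thesis by (simp add: same_direction_iff_det)
qed

lemma real_common_root:
  fixes w :: "real ^ 2"
  assumes "w \<noteq> 0" "qf q1 w = 0" "qf q2 w = 0"
  shows "common_root q1 q2"
proof -
  let ?z = "(\<chi> i. of_real (w $ i)) :: complex ^ 2"
  have "qf q ?z = of_real (qf q w)" for q by (simp add: qf_def)
  moreover have "?z \<noteq> 0" using assms(1) by (simp add: vec2_eq_0_iff)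
  ultimately show ?thesis using assms unfolding common_root_def by (intro exI[of _ ?z]) simp
qed

text \<open>If the Jacobian vanishes identically, the coefficient vectors are linearly dependent, so a
  complex root of a form that is not identically zero is also a root of the other one.\<close>

lemma Jac_nonzero_if_no_common_root:
  assumes "\<not> common_root q1 q2"
  shows "\<exists>v :: real ^ 2. Jac q1 q2 v \<noteq> 0"
proof (rule ccontr)
  assume "\<not> ?thesis"
  then have z: "jac20 q1 q2 = 0" "jac11 q1 q2 = 0" "jac02 q1 q2 = 0"
    unfolding Jac_nonzero_iff by auto
  obtain w1 :: "complex ^ 2" where w1: "w1 \<noteq> 0" "qf q1 w1 = 0" using qf_complex_root by blast
  obtain w2 :: "complex ^ 2" where w2: "w2 \<noteq> 0" "qf q2 w2 = 0" using qf_complex_root by blast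
  have "qf q1 w2 \<noteq> 0" "qf q2 w1 \<noteq> 0" using assms w1 w2 by (auto simp: common_root_def)
  then have nz: "ca q1 \<noteq> 0 \<or> cb q1 \<noteq> 0 \<or> cc q1 \<noteq> 0" by (auto simp: qf_def)
  have "complex_of_real (ca q1) * qf q2 w1 = of_real (ca q2) * qf q1 w1"
    "complex_of_real (cb q1) * qf q2 w1 = of_real (cb q2) * qf q1 w1"
    "complex_of_real (cc q1) * qf q2 w1 = of_real (cc q2) * qf q1 w1"
  proof -
    have e: "complex_of_real (ca q1) * of_real (cb q2) = of_real (ca q2) * of_real (cb q1)"
      "complex_of_real (ca q1) * of_real (cc q2) = of_real (ca q2) * of_real (cc q1)"
      "complex_of_real (cb q1) * of_real (cc q2) = of_real (cb q2) * of_real (cc q1)"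
      using z unfolding jac_coeff_defs by (simp_all flip: of_real_mult)
    show "complex_of_real (ca q1) * qf q2 w1 = of_real (ca q2) * qf q1 w1"
      "complex_of_real (cb q1) * qf q2 w1 = of_real (cb q2) * qf q1 w1"
      "complex_of_real (cc q1) * qf q2 w1 = of_real (cc q2) * qf q1 w1"
      unfolding qf_def using e by algebra+
  qed
  with nz w1(2) \<open>qf q2 w1 \<noteq> 0\<close> show False by auto
qed

text \<open>Here \<open>E\<^sub>1 w\<close> is nonzero, orthogonal to \<open>w\<close> and parallel to \<open>E\<^sub>2 w\<close>.\<close>

lemma Jac_and_q1_root_imp_q2_root:
  fixes w :: "'a::real_normed_field ^ 2"
  assumes det: "det (qmat q1 :: real ^ 2 ^ 2) \<noteq> 0" and w: "w \<noteq> 0"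
    and J: "Jac q1 q2 w = 0" and q1: "qf q1 w = 0"
  shows "qf q2 w = 0"
proof -
  define p q r s where "p = (qmat q1 *v w) $ 1" and "q = (qmat q1 *v w) $ 2"
    and "r = (qmat q2 *v w) $ 1" and "s = (qmat q2 *v w) $ 2"
  have "p \<noteq> 0 \<or> q \<noteq> 0"
  proof (rule ccontr)
    assume "\<not> ?thesis"
    then have pq: "p = 0" "q = 0" by auto
    have d: "of_real (ca q1 * cc q1 - (cb q1)\<^sup>2) \<noteq> (0 :: 'a)"
      using det by (simp add: det_2 qmat_def power2_eq_square del: of_real_diff of_real_mult)
    have "of_real (ca q1 * cc q1 - (cb q1)\<^sup>2) * w $ 1
        = of_real (cc q1) * p - of_real (cb q1) * q"
      "of_real (ca q1 * cc q1 - (cb q1)\<^sup>2) * w $ 2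
        = of_real (ca q1) * q - of_real (cb q1) * p"
      by (simp_all add: p_def q_def qmat_mult power2_eq_square algebra_simps)
    with d pq w show False by (simp add: vec2_eq_0_iff)
  qed
  moreover have "p * s = q * r" using J by (simp add: Jac_eq_det_images p_def q_def r_def s_def)
  moreover have "w $ 1 * p + w $ 2 * q = 0"
    using q1 by (simp add: qf_eq_bilin bilin_def sum_2 p_def q_def)
  ultimately have "w $ 1 * r + w $ 2 * s = 0"
    by algebra
  then show ?thesis by (simp add: qf_eq_bilin bilin_def sum_2 r_def s_def)
qed

section \<open>Critical directions of the quotient\<close>

lemma quot_chart_derivatives:
  fixes t :: "'a::real_normed_field"
  shows "qf q1 (vector [t, 1] :: 'a ^ 2) \<noteq> 0 \<Longrightarrow>
      ((\<lambda>t. quot q1 q2 (vector [t, 1])) has_field_derivative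
        - 2 * Jac q1 q2 (vector [t, 1]) / (qf q1 (vector [t, 1]))\<^sup>2) (at t)"
    and "qf q1 (vector [1, t] :: 'a ^ 2) \<noteq> 0 \<Longrightarrow>
      ((\<lambda>t. quot q1 q2 (vector [1, t])) has_field_derivative
        2 * Jac q1 q2 (vector [1, t]) / (qf q1 (vector [1, t]))\<^sup>2) (at t)"
proof -
  assume "qf q1 (vector [t, 1] :: 'a ^ 2) \<noteq> 0"
  then show "((\<lambda>t. quot q1 q2 (vector [t, 1])) has_field_derivative
        - 2 * Jac q1 q2 (vector [t, 1]) / (qf q1 (vector [t, 1]))\<^sup>2) (at t)"
    unfolding quot_def qf_def Jac_eq jac_coeff_defs
    by (auto intro!: derivative_eq_intros simp: power2_eq_square)
       (simp add: algebra_simps)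
next
  assume "qf q1 (vector [1, t] :: 'a ^ 2) \<noteq> 0"
  then show "((\<lambda>t. quot q1 q2 (vector [1, t])) has_field_derivative
        2 * Jac q1 q2 (vector [1, t]) / (qf q1 (vector [1, t]))\<^sup>2) (at t)"
    unfolding quot_def qf_def Jac_eq jac_coeff_defs
    by (auto intro!: derivative_eq_intros simp: power2_eq_square)
       (simp add: algebra_simps)
qed

lemma stationary_iff_Jac:
  fixes w :: "'a::real_normed_field ^ 2"
  shows "stationary q1 q2 w \<longleftrightarrow> qf q1 w \<noteq> 0 \<and> Jac q1 q2 w = 0"
proof (cases "qf q1 w = 0")
  case True
  then show ?thesis by (simp add: stationary_def)
next
  case q: False
  have c2: "((\<lambda>t. quot q1 q2 (vector [t, 1])) has_field_derivative 0) (at (w $ 1 / w $ 2))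
      \<longleftrightarrow> Jac q1 q2 w = 0" if y: "w $ 2 \<noteq> 0"
  proof -
    let ?t = "w $ 1 / w $ 2"
    have "qf q1 w = (w $ 2)\<^sup>2 * qf q1 (vector [?t, 1])"
      "Jac q1 q2 w = (w $ 2)\<^sup>2 * Jac q1 q2 (vector [?t, 1])"
      using chart_2[OF y] qf_scale Jac_scale by metis+
    with q y quot_chart_derivatives(1)[of q1 ?t q2] show ?thesis
      by (auto dest: DERIV_unique)
  qed
  have c1: "((\<lambda>t. quot q1 q2 (vector [1, t])) has_field_derivative 0) (at (w $ 2 / w $ 1))
      \<longleftrightarrow> Jac q1 q2 w = 0" if x: "w $ 1 \<noteq> 0"
  proof -
    let ?t = "w $ 2 / w $ 1"
    have "qf q1 w = (w $ 1)\<^sup>2 * qf q1 (vector [1, ?t])"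
      "Jac q1 q2 w = (w $ 1)\<^sup>2 * Jac q1 q2 (vector [1, ?t])"
      using chart_1[OF x] qf_scale Jac_scale by metis+
    with q x quot_chart_derivatives(2)[of q1 ?t q2] show ?thesis
      by (auto dest: DERIV_unique)
  qed
  from q have "w \<noteq> 0" by auto
  with q c1 c2 show ?thesis by (auto simp: stationary_def vec2_eq_0_iff)
qed

lemma local_extremum_imp_deriv_0:
  assumes "local_extremum g t" and D: "(g has_field_derivative D) (at t)"
  shows "D = 0"
  using assms(1) unfolding local_extremum_def eventually_nhds_metric
proof (elim disjE exE conjE)
  fix d assume "0 < d" "\<forall>x. dist x t < d \<longrightarrow> g x \<le> g t"
  then show ?thesis using DERIV_local_max[OF D] by (auto simp: dist_real_def abs_minus_commute)
next
  fix d assume "0 < d" "\<forall>x. dist x t < d \<longrightarrow> g t \<le> g x"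
  then show ?thesis using DERIV_local_min[OF D] by (auto simp: dist_real_def abs_minus_commute)
qed

lemma local_extremal_imp_Jac_0:
  assumes "local_extremal q1 q2 w"
  shows "Jac q1 q2 w = 0"
proof -
  from assms have q: "qf q1 w \<noteq> 0" by (simp add: local_extremal_def)
  then consider "w $ 2 \<noteq> 0" | "w $ 1 \<noteq> 0" by (metis qf_zero vec2_eq_0_iff)
  then show ?thesis
  proof cases
    case 1
    let ?t = "w $ 1 / w $ 2"
    have e: "qf q1 w = (w $ 2)\<^sup>2 * qf q1 (vector [?t, 1])"
      "Jac q1 q2 w = (w $ 2)\<^sup>2 * Jac q1 q2 (vector [?t, 1])"
      using chart_2[OF 1] qf_scale Jac_scale by metis+
    have "local_extremum (\<lambda>t. quot q1 q2 (vector [t, 1])) ?t"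
      using assms 1 by (simp add: local_extremal_def)
    from local_extremum_imp_deriv_0[OF this quot_chart_derivatives(1)] q e show ?thesis by simp
  next
    case 2
    let ?t = "w $ 2 / w $ 1"
    have e: "qf q1 w = (w $ 1)\<^sup>2 * qf q1 (vector [1, ?t])"
      "Jac q1 q2 w = (w $ 1)\<^sup>2 * Jac q1 q2 (vector [1, ?t])"
      using chart_1[OF 2] qf_scale Jac_scale by metis+
    have "local_extremum (\<lambda>t. quot q1 q2 (vector [1, t])) ?t"
      using assms 2 by (simp add: local_extremal_def)
    from local_extremum_imp_deriv_0[OF this quot_chart_derivatives(2)] q e show ?thesis by simp
  qed
qed

text \<open>At a root \<open>w\<close> of the Jacobian with \<open>q\<^sub>1 w \<noteq> 0\<close> the vectors \<open>E\<^sub>1 w\<close> and \<open>E\<^sub>2 w\<close> are parallel, so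
  \<open>w\<close> lies in the kernel of \<open>E\<^sub>2 - f(w) E\<^sub>1\<close>. A symmetric matrix of size 2 with kernel vector \<open>w\<close>
  defines a multiple of the square of the linear form vanishing at \<open>w\<close>. The difference
  \<open>f - f(w)\<close> thus changes sign only where \<open>q\<^sub>1\<close> does, which is why every critical direction is
  extremal, without inflections.\<close>

lemma rank_one_remainder:
  fixes w :: "'a::real_normed_field ^ 2"
  assumes q: "qf q1 w \<noteq> 0" and J: "Jac q1 q2 w = 0"
  obtains \<kappa> where
    "\<And>v. qf q2 v = quot q1 q2 w * qf q1 v + \<kappa> * (w $ 1 * v $ 2 - w $ 2 * v $ 1)\<^sup>2"
proof -
  define x y where "x = w $ 1" and "y = w $ 2"
  define m where "m = quot q1 q2 w"
  define e f g :: 'a where "e = of_real (ca q2) - m * of_real (ca q1)"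
    and "f = of_real (cb q2) - m * of_real (cb q1)" and "g = of_real (cc q2) - m * of_real (cc q1)"
  define p q r s where "p = (qmat q1 *v w) $ 1" and "q = (qmat q1 *v w) $ 2"
    and "r = (qmat q2 *v w) $ 1" and "s = (qmat q2 *v w) $ 2"
  have q1: "x * p + y * q \<noteq> 0"
    using q by (simp add: qf_eq_bilin bilin_def sum_2 p_def q_def x_def y_def)
  have "m * (x * p + y * q) = x * r + y * s"
    using q by (simp add: m_def quot_def qf_eq_bilin bilin_def sum_2
        p_def q_def r_def s_def x_def y_def)
  moreover have "p * s = q * r" using J by (simp add: Jac_eq_det_images p_def q_def r_def s_def)
  ultimately have "(r - m * p) * (x * p + y * q) = 0" "(s - m * q) * (x * p + y * q) = 0"
    by algebra+
  with q1 have "r - m * p = 0" "s - m * q = 0" by auto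
  then have ker: "e * x + f * y = 0" "f * x + g * y = 0"
    by (simp_all add: p_def q_def r_def s_def e_def f_def g_def x_def y_def qmat_mult algebra_simps)
  have v: "qf q2 v = m * qf q1 v + (e * (v $ 1)\<^sup>2 + 2 * f * v $ 1 * v $ 2 + g * (v $ 2)\<^sup>2)" for v
    by (simp add: qf_def e_def f_def g_def algebra_simps)
  have "\<exists>\<kappa>. e = \<kappa> * y\<^sup>2 \<and> f = - \<kappa> * x * y \<and> g = \<kappa> * x\<^sup>2"
  proof (cases "y = 0")
    case True
    with q1 have "x \<noteq> 0" by auto
    with True ker show ?thesis by (intro exI[of _ "g / x\<^sup>2"]) auto
  next
    case False
    have "f * y = - e * x" using ker(1) by (simp add: eq_neg_iff_add_eq_0 add.commute)
    moreover have "y * (g * y\<^sup>2 - e * x\<^sup>2) = 0" using ker by algebra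
    ultimately show ?thesis using False
      by (intro exI[of _ "e / y\<^sup>2"]) (auto simp: field_simps power2_eq_square)
  qed
  then obtain \<kappa> where "e = \<kappa> * y\<^sup>2" "f = - \<kappa> * x * y" "g = \<kappa> * x\<^sup>2" by blast
  then have "qf q2 v = m * qf q1 v + \<kappa> * (x * v $ 2 - y * v $ 1)\<^sup>2" for v
    unfolding v by (simp add: power2_eq_square algebra_simps)
  then show ?thesis using that unfolding m_def x_def y_def by blast
qed

text \<open>The factor \<open>p t * p t0\<close> is positive near \<open>t0\<close>, so \<open>\<kappa> / p t0\<close> decides the sign of
  \<open>g t - g t0\<close>.\<close>

lemma local_extremum_of_remainder:
  fixes g d p :: "real \<Rightarrow> real"
  assumes g: "\<And>t. p t \<noteq> 0 \<Longrightarrow> g t = m + \<kappa> * (d t)\<^sup>2 / p t"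
    and p: "isCont p t0" "p t0 \<noteq> 0" and d: "d t0 = 0"
  shows "local_extremum g t0"
proof -
  have "((\<lambda>t. p t * p t0) \<longlongrightarrow> p t0 * p t0) (nhds t0)"
    using p(1) by (intro tendsto_intros) (simp add: isCont_def tendsto_at_iff_tendsto_nhds)
  moreover have "0 < p t0 * p t0" using p(2) by (simp add: zero_less_mult_iff) linarith
  ultimately have ev: "\<forall>\<^sub>F t in nhds t0. 0 < p t * p t0" by (rule order_tendstoD)
  have g0: "g t0 = m" using g p d by simp
  have sgn: "g t - g t0 = \<kappa> / p t0 * (p t * p t0 * (d t / p t)\<^sup>2)"
    if "0 < p t * p t0" for t
  proof -
    from that have "p t \<noteq> 0" by auto
    with p(2) show ?thesis by (simp add: g0 g power2_eq_square)
  qed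
  show ?thesis
  proof (cases "0 \<le> \<kappa> / p t0")
    case True
    have "\<forall>\<^sub>F t in nhds t0. g t0 \<le> g t"
      using ev
    proof eventually_elim
      case (elim t)
      have "0 \<le> g t - g t0"
        unfolding sgn[OF elim]
        by (rule mult_nonneg_nonneg[OF True mult_nonneg_nonneg[OF less_imp_le[OF elim] zero_le_power2]])
      then show ?case by simp
    qed
    then show ?thesis by (simp add: local_extremum_def)
  next
    case False
    have "\<forall>\<^sub>F t in nhds t0. g t \<le> g t0"
      using ev
    proof eventually_elim
      case (elim t)
      have "g t - g t0 \<le> 0"
        unfolding sgn[OF elim] using False
        by (intro mult_nonpos_nonneg mult_nonneg_nonneg[OF less_imp_le[OF elim] zero_le_power2]) simp
      then show ?case by simp
    qed
    then show ?thesis by (simp add: local_extremum_def)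
  qed
qed

lemma local_extremal_iff_Jac:
  "local_extremal q1 q2 w \<longleftrightarrow> qf q1 w \<noteq> 0 \<and> Jac q1 q2 w = 0"
proof
  assume "local_extremal q1 q2 w"
  then show "qf q1 w \<noteq> 0 \<and> Jac q1 q2 w = 0"
    using local_extremal_imp_Jac_0 by (auto simp: local_extremal_def)
next
  assume R: "qf q1 w \<noteq> 0 \<and> Jac q1 q2 w = 0"
  then obtain \<kappa> where \<kappa>:
    "\<And>v. qf q2 v = quot q1 q2 w * qf q1 v + \<kappa> * (w $ 1 * v $ 2 - w $ 2 * v $ 1)\<^sup>2"
    using rank_one_remainder by blast
  have f: "quot q1 q2 v = quot q1 q2 w + \<kappa> * (w $ 1 * v $ 2 - w $ 2 * v $ 1)\<^sup>2 / qf q1 v"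
    if "qf q1 v \<noteq> 0" for v
    using that by (subst (1) quot_def) (simp add: \<kappa> field_simps)
  have "local_extremum (\<lambda>t. quot q1 q2 (vector [t, 1])) (w $ 1 / w $ 2)" if y: "w $ 2 \<noteq> 0"
  proof (rule local_extremum_of_remainder)
    show "quot q1 q2 (vector [t, 1])
        = quot q1 q2 w + \<kappa> * (w $ 1 - w $ 2 * t)\<^sup>2 / qf q1 (vector [t, 1])"
      if "qf q1 (vector [t, 1] :: real ^ 2) \<noteq> 0" for t
      using f[OF that] by simp
    show "isCont (\<lambda>t. qf q1 (vector [t, 1])) (w $ 1 / w $ 2)"
      unfolding qf_def vector_2 by (intro continuous_intros)
    have "qf q1 w = (w $ 2)\<^sup>2 * qf q1 (vector [w $ 1 / w $ 2, 1])"
      using chart_2[OF y] qf_scale by metis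
    with R show "qf q1 (vector [w $ 1 / w $ 2, 1] :: real ^ 2) \<noteq> 0" by auto
    show "w $ 1 - w $ 2 * (w $ 1 / w $ 2) = 0" using y by simp
  qed
  moreover have "local_extremum (\<lambda>t. quot q1 q2 (vector [1, t])) (w $ 2 / w $ 1)"
    if x: "w $ 1 \<noteq> 0"
  proof (rule local_extremum_of_remainder)
    show "quot q1 q2 (vector [1, t])
        = quot q1 q2 w + \<kappa> * (w $ 1 * t - w $ 2)\<^sup>2 / qf q1 (vector [1, t])"
      if "qf q1 (vector [1, t] :: real ^ 2) \<noteq> 0" for t
      using f[OF that] by simp
    show "isCont (\<lambda>t. qf q1 (vector [1, t])) (w $ 2 / w $ 1)"
      unfolding qf_def vector_2 by (intro continuous_intros)
    have "qf q1 w = (w $ 1)\<^sup>2 * qf q1 (vector [1, w $ 2 / w $ 1])"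
      using chart_1[OF x] qf_scale by metis
    with R show "qf q1 (vector [1, w $ 2 / w $ 1] :: real ^ 2) \<noteq> 0" by auto
    show "w $ 1 * (w $ 2 / w $ 1) - w $ 2 = 0" using x by simp
  qed
  ultimately show "local_extremal q1 q2 w" using R by (simp add: local_extremal_def)
qed

text \<open>Without a common root, a nondegenerate \<open>q\<^sub>1\<close> cannot vanish at a root of the Jacobian, so no
  root is lost to the domain of \<open>f\<close>.\<close>

lemma critical_iff_Jac_root:
  fixes w1 w2 w :: "'a::real_normed_field ^ 2"
  assumes r: "roots_of (Jac q1 q2) w1 w2" and det: "det (qmat q1 :: real ^ 2 ^ 2) \<noteq> 0"
    and nc: "\<And>v :: 'a ^ 2. v \<noteq> 0 \<Longrightarrow> qf q1 v = 0 \<Longrightarrow> qf q2 v \<noteq> 0"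
  shows "qf q1 w \<noteq> 0 \<and> Jac q1 q2 w = 0 \<longleftrightarrow> same_direction w w1 \<or> same_direction w w2"
proof (cases "w = 0")
  case True
  with roots_of_nonzero[OF r] show ?thesis by (simp add: same_direction_def)
next
  case False
  with Jac_and_q1_root_imp_q2_root[OF det] nc have "Jac q1 q2 w = 0 \<Longrightarrow> qf q1 w \<noteq> 0" by blast
  with roots_of_zero_iff[OF r False] show ?thesis by blast
qed

section \<open>Global extrema over a positive definite denominator\<close>

lemma pos_def_imp:
  assumes "pos_def q"
  shows "0 < ca q" and "0 < ca q * cc q - (cb q)\<^sup>2"
proof -
  have p: "0 < qf q w" if "w \<noteq> 0" for w :: "real ^ 2" using assms that by (simp add: pos_def_def)
  show a: "0 < ca q" using p[of "vector [1, 0]"] by (simp add: qf_def vec2_eq_0_iff)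
  have "0 < qf q (vector [- cb q, ca q] :: real ^ 2)"
    using a by (intro p) (simp add: vec2_eq_0_iff)
  also have "\<dots> = ca q * (ca q * cc q - (cb q)\<^sup>2)"
    by (simp add: qf_def power2_eq_square algebra_simps)
  finally show "0 < ca q * cc q - (cb q)\<^sup>2" using a by (simp add: zero_less_mult_iff)
qed

text \<open>For a form \<open>A\<alpha>\<^sup>2 + B\<alpha>\<beta> + C\<beta>\<^sup>2\<close> apolar to \<open>q = (a, b, c)\<close> the discriminant times \<open>a\<^sup>2\<close> is
  \<open>(a B - 2 b A)\<^sup>2 + 4 A\<^sup>2 det E\<close>.\<close>

lemma apolar_discriminant_nonneg:
  fixes A B C :: real
  assumes "pos_def q" and ap: "ca q * C - cb q * B + cc q * A = 0"
  shows "0 \<le> B\<^sup>2 - 4 * A * C"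
proof -
  have "(ca q)\<^sup>2 * (B\<^sup>2 - 4 * A * C)
      = (ca q * B - 2 * cb q * A)\<^sup>2 + 4 * A\<^sup>2 * (ca q * cc q - (cb q)\<^sup>2)"
    using ap by algebra
  also have "\<dots> \<ge> 0" using pos_def_imp[OF assms(1)] by simp
  finally show ?thesis using pos_def_imp(1)[OF assms(1)] by (simp add: zero_le_mult_iff)
qed

lemma Jac_real_roots:
  assumes pd: "pos_def q1 \<or> pos_def q2" and nz: "\<exists>v :: real ^ 2. Jac q1 q2 v \<noteq> 0"
  shows "\<exists>w1 w2 :: real ^ 2. roots_of (Jac q1 q2) w1 w2"
proof -
  have "ca q1 * jac02 q1 q2 - cb q1 * jac11 q1 q2 + cc q1 * jac20 q1 q2 = 0"
    "ca q2 * jac02 q1 q2 - cb q2 * jac11 q1 q2 + cc q2 * jac20 q1 q2 = 0"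
    by (simp_all add: jac_coeff_defs algebra_simps)
  with pd have "0 \<le> (jac11 q1 q2)\<^sup>2 - 4 * jac20 q1 q2 * jac02 q1 q2"
    using apolar_discriminant_nonneg by blast
  with nz show ?thesis
    unfolding Jac_nonzero_iff
    by (intro roots_of_exist[where s = "sqrt ((jac11 q1 q2)\<^sup>2 - 4 * jac20 q1 q2 * jac02 q1 q2)"])
       (auto simp: Jac_eq)
qed

lemma global_extremum_imp_Jac_0:
  assumes pd: "pos_def q1" and ex: "global_min q1 q2 w \<or> global_max q1 q2 w"
  shows "Jac q1 q2 w = 0"
proof -
  have nz: "qf q1 v \<noteq> 0" if "v \<noteq> 0" for v :: "real ^ 2"
    using pd that by (auto simp: pos_def_def dest: spec[of _ v])
  have n: "qf q1 (vector [t, 1] :: real ^ 2) \<noteq> 0" "qf q1 (vector [1, t] :: real ^ 2) \<noteq> 0" for t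
    by (rule nz; simp add: vec2_eq_0_iff)+
  have c2: "quot q1 q2 (vector [w $ 1 / w $ 2, 1]) = quot q1 q2 w" if "w $ 2 \<noteq> 0"
    using chart_2[OF that] quot_scale[OF that] by metis
  have c1: "quot q1 q2 (vector [1, w $ 2 / w $ 1]) = quot q1 q2 w" if "w $ 1 \<noteq> 0"
    using chart_1[OF that] quot_scale[OF that] by metis
  have "local_extremal q1 q2 w"
    using ex
  proof
    assume "global_min q1 q2 w"
    then show ?thesis using n c1 c2
      by (simp add: local_extremal_def local_extremum_def global_min_def)
  next
    assume "global_max q1 q2 w"
    then show ?thesis using n c1 c2
      by (simp add: local_extremal_def local_extremum_def global_max_def)
  qed
  then show ?thesis by (rule local_extremal_imp_Jac_0)
qed

lemma remainder_imp_global: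
  assumes pd: "pos_def q1" and w: "w \<noteq> 0"
    and \<kappa>: "\<And>v. qf q2 v = quot q1 q2 w * qf q1 v + \<kappa> * (w $ 1 * v $ 2 - w $ 2 * v $ 1)\<^sup>2"
  shows "0 \<le> \<kappa> \<Longrightarrow> global_min q1 q2 w" and "\<kappa> \<le> 0 \<Longrightarrow> global_max q1 q2 w"
proof -
  have p: "0 < qf q1 v" if "qf q1 v \<noteq> 0" for v :: "real ^ 2"
    using pd that by (metis pos_def_def qf_zero)
  have qw: "qf q1 w \<noteq> 0" using pd w by (auto simp: pos_def_def dest: spec[of _ w])
  have f: "quot q1 q2 v = quot q1 q2 w + \<kappa> * (w $ 1 * v $ 2 - w $ 2 * v $ 1)\<^sup>2 / qf q1 v"
    if "qf q1 v \<noteq> 0" for v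
    using that by (subst (1) quot_def) (simp add: \<kappa> field_simps)
  show "global_min q1 q2 w" if "0 \<le> \<kappa>"
    unfolding global_min_def
  proof (intro conjI allI impI qw)
    fix v :: "real ^ 2" assume v: "qf q1 v \<noteq> 0"
    have "0 \<le> \<kappa> * (w $ 1 * v $ 2 - w $ 2 * v $ 1)\<^sup>2 / qf q1 v" using that p[OF v] by simp
    with f[OF v] show "quot q1 q2 w \<le> quot q1 q2 v" by linarith
  qed
  show "global_max q1 q2 w" if "\<kappa> \<le> 0"
    unfolding global_max_def
  proof (intro conjI allI impI qw)
    fix v :: "real ^ 2" assume v: "qf q1 v \<noteq> 0"
    have "\<kappa> * (w $ 1 * v $ 2 - w $ 2 * v $ 1)\<^sup>2 / qf q1 v \<le> 0"
      using that p[OF v] by (simp add: divide_nonpos_pos mult_nonpos_nonneg)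
    with f[OF v] show "quot q1 q2 v \<le> quot q1 q2 w" by linarith
  qed
qed

lemma Jac_0_imp_global_extremum:
  assumes pd: "pos_def q1" and w: "w \<noteq> 0" and J: "Jac q1 q2 w = 0"
  shows "global_min q1 q2 w \<or> global_max q1 q2 w"
proof -
  have "qf q1 w \<noteq> 0" using pd w by (auto simp: pos_def_def dest: spec[of _ w])
  then obtain \<kappa> where
    "\<And>v. qf q2 v = quot q1 q2 w * qf q1 v + \<kappa> * (w $ 1 * v $ 2 - w $ 2 * v $ 1)\<^sup>2"
    using rank_one_remainder[OF _ J] by blast
  from remainder_imp_global[OF pd w this] show ?thesis by (cases "0 \<le> \<kappa>") auto
qed

text \<open>If both roots were minima (or both maxima), \<open>f\<close> would take the same value at two independent
  directions, so the rank one remainder at the first root would vanish at the second and hence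
  identically. Then \<open>f\<close> would be constant, and its Jacobian zero.\<close>

lemma global_min_max_roots:
  assumes pd: "pos_def q1" and nz: "\<exists>v :: real ^ 2. Jac q1 q2 v \<noteq> 0"
  shows "\<exists>w1 w2 :: real ^ 2. roots_of (Jac q1 q2) w1 w2 \<and> \<not> same_direction w1 w2 \<and>
           global_min q1 q2 w1 \<and> global_max q1 q2 w2"
proof -
  obtain w1 w2 :: "real ^ 2" where r: "roots_of (Jac q1 q2) w1 w2"
    using Jac_real_roots nz pd by blast
  have w: "w1 \<noteq> 0" "w2 \<noteq> 0" using roots_of_nonzero[OF r] by auto
  have q: "qf q1 w1 \<noteq> 0" "qf q1 w2 \<noteq> 0"
    using pd w by (auto simp: pos_def_def dest: spec[of _ w1] spec[of _ w2])
  have sd: "\<not> same_direction w1 w2" "\<not> same_direction w2 w1"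
    using double_Jac_root_is_common_root(1)[OF r]
      double_Jac_root_is_common_root(1)[OF roots_of_sym[OF r]] q by blast+
  have J: "Jac q1 q2 w1 = 0" "Jac q1 q2 w2 = 0" using roots_of_vanish[OF r] by auto
  have ne: "quot q1 q2 w1 \<noteq> quot q1 q2 w2"
  proof
    assume eq: "quot q1 q2 w1 = quot q1 q2 w2"
    obtain \<kappa> where \<kappa>:
      "\<And>v. qf q2 v = quot q1 q2 w1 * qf q1 v + \<kappa> * (w1 $ 1 * v $ 2 - w1 $ 2 * v $ 1)\<^sup>2"
      using rank_one_remainder[OF q(1) J(1)] by blast
    have "qf q2 w2 = quot q1 q2 w1 * qf q1 w2" using q(2) unfolding eq by (simp add: quot_def)
    with \<kappa>[of w2] sd(1) w have "\<kappa> = 0" by (simp add: same_direction_iff_det)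
    with \<kappa> have c: "quot q1 q2 v = quot q1 q2 w1" if "v \<noteq> 0" for v
      using pd that by (auto simp: pos_def_def quot_def[of _ _ v] dest: spec[of _ v])
    have "Jac q1 q2 v = 0" for v :: "real ^ 2"
    proof (cases "v = 0")
      case True
      then show ?thesis by (simp add: Jac_eq)
    next
      case False
      have "global_min q1 q2 v"
        using False c pd unfolding global_min_def by (metis order_refl pos_def_def qf_zero less_irrefl)
      then show ?thesis using global_extremum_imp_Jac_0[OF pd] by blast
    qed
    with nz show False by blast
  qed
  have ex: "global_min q1 q2 w1 \<or> global_max q1 q2 w1" "global_min q1 q2 w2 \<or> global_max q1 q2 w2"
    using Jac_0_imp_global_extremum[OF pd] w J by blast+
  have "\<not> (global_min q1 q2 w1 \<and> global_min q1 q2 w2)"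
    "\<not> (global_max q1 q2 w1 \<and> global_max q1 q2 w2)"
    using ne q unfolding global_min_def global_max_def by (metis order_antisym)+
  with ex r roots_of_sym[OF r] sd show ?thesis by blast
qed

section \<open>The pencil of matrices\<close>

lemma eigenvector_imp_Jac_0:
  fixes w :: "'a::real_normed_field ^ 2"
  assumes "qmat q2 *v w = \<mu> *s (qmat q1 *v w)"
  shows "Jac q1 q2 w = 0"
  by (simp add: Jac_eq_det_images assms)

lemma Jac_0_imp_eigenvector:
  fixes w :: "'a::real_normed_field ^ 2"
  assumes nz: "qmat q1 *v w \<noteq> 0" and J: "Jac q1 q2 w = 0"
  shows "\<exists>!\<mu>. qmat q2 *v w = \<mu> *s (qmat q1 *v w)"
proof -
  define p r where "p = qmat q1 *v w" and "r = qmat q2 *v w"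
  have p: "p \<noteq> 0" using nz by (simp add: p_def)
  have d: "p $ 1 * r $ 2 = p $ 2 * r $ 1" using J by (simp add: Jac_eq_det_images p_def r_def)
  have "\<exists>\<mu>. r = \<mu> *s p"
  proof (cases "p $ 1 = 0")
    case True
    with p d show ?thesis
      by (intro exI[of _ "r $ 2 / p $ 2"]) (auto simp: vec2_eq_0_iff vec_eq_iff forall_2)
  next
    case False
    with d show ?thesis
      by (intro exI[of _ "r $ 1 / p $ 1"]) (auto simp: vec_eq_iff forall_2 field_simps)
  qed
  moreover have "\<mu> = \<nu>" if "r = \<mu> *s p" "r = \<nu> *s p" for \<mu> \<nu>
    using that p by auto
  ultimately show ?thesis unfolding p_def r_def by blast
qed

text \<open>Pairing \<open>E\<^sub>2 w = \<mu> E\<^sub>1 w\<close> with the conjugate of \<open>w\<close> gives \<open>h\<^sub>2 = \<mu> h\<^sub>1\<close>, where the Hermitian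
  value \<open>h\<^sub>i\<close> is \<open>q\<^sub>i\<close> of the real part plus \<open>q\<^sub>i\<close> of the imaginary part of \<open>w\<close>; definiteness
  makes \<open>h\<^sub>1\<close> nonzero.\<close>

lemma eigenvalue_real:
  fixes w :: "complex ^ 2"
  assumes def: "pos_def_matrix (qmat q1) \<or> neg_def_matrix (qmat q1)"
    and w: "w \<noteq> 0" and e: "qmat q2 *v w = \<mu> *s (qmat q1 *v w)"
  shows "\<mu> \<in> \<real>"
proof -
  define u v :: "real ^ 2" where "u = (\<chi> i. Re (w $ i))" and "v = (\<chi> i. Im (w $ i))"
  define h where "h q = qf q u + qf q v" for q
  have h: "of_real (h q) = cnj (w $ 1) * (qmat q *v w) $ 1 + cnj (w $ 2) * (qmat q *v w) $ 2" for q
    by (simp add: h_def qf_def u_def v_def qmat_mult complex_eq_iff power2_eq_square algebra_simps)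
  have "of_real (h q2) = \<mu> * of_real (h q1)"
    unfolding h e by (simp add: algebra_simps)
  moreover have "h q1 \<noteq> 0"
  proof -
    have uv: "u \<noteq> 0 \<or> v \<noteq> 0"
      using w by (auto simp: u_def v_def vec2_eq_0_iff complex_eq_iff)
    from def show ?thesis
    proof
      assume "pos_def_matrix (qmat q1)"
      then have "0 < qf q1 x" if "x \<noteq> 0" for x :: "real ^ 2"
        using that by (simp add: pos_def_matrix_def qf_eq_bilin)
      with uv show ?thesis unfolding h_def
        by (metis add_pos_pos add.right_neutral add_0 less_irrefl qf_zero)
    next
      assume "neg_def_matrix (qmat q1)"
      then have "qf q1 x < 0" if "x \<noteq> 0" for x :: "real ^ 2"
        using that by (simp add: neg_def_matrix_def qf_eq_bilin)
      with uv show ?thesis unfolding h_def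
        by (metis add_neg_neg add.right_neutral add_0 less_irrefl qf_zero)
    qed
  qed
  ultimately have "\<mu> = of_real (h q2 / h q1)" by (simp add: field_simps)
  then show ?thesis by (metis Reals_of_real)
qed

section \<open>Bisectors\<close>

text \<open>The squared cosines of the angles from \<open>w\<close> to \<open>u\<^sub>1\<close> and to \<open>u\<^sub>2\<close>, cleared of denominators,
  differ by a form that is quadratic in \<open>w\<close>. For definite \<open>q\<^sub>2\<close> this form vanishes just on the
  bisectors; expanding it shows that it is a multiple of the Jacobian of \<open>q\<^sub>2\<close> and the form with
  roots \<open>u\<^sub>1\<close>, \<open>u\<^sub>2\<close>.\<close>

lemma bisector_identity:
  fixes u1 u2 w :: "real ^ 2"
  assumes "roots_of (qf q1) u1 u2"
  obtains c where "(bilin (qmat q2) u1 w)\<^sup>2 * qf q2 u2 - (bilin (qmat q2) u2 w)\<^sup>2 * qf q2 u1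
    = c * Jac q1 q2 w"
proof -
  define a b c x y p1 p2 r1 r2 where "a = ca q2" and "b = cb q2" and "c = cc q2"
    and "x = w $ 1" and "y = w $ 2" and "p1 = u1 $ 1" and "p2 = u1 $ 2"
    and "r1 = u2 $ 1" and "r2 = u2 $ 2"
  note defs = a_def b_def c_def x_def y_def p1_def p2_def r1_def r2_def
  obtain k where k: "k \<noteq> 0" and q1: "ca q1 = k * p2 * r2"
    "2 * cb q1 = - k * (p1 * r2 + p2 * r1)" "cc q1 = k * p1 * r1"
    using roots_of_coeffs[OF assms, of "ca q1" "2 * cb q1" "cc q1"]
    by (auto simp: qf_def defs)
  define j where "j = (2 * p2 * r2 * b + a * (p1 * r2 + p2 * r1)) * x\<^sup>2
      + 2 * (p2 * r2 * c - a * p1 * r1) * x * y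
      + (- (p1 * r2 + p2 * r1) * c - 2 * b * p1 * r1) * y\<^sup>2"
  have "2 * Jac q1 q2 w = (2 * ca q1 * b - a * (2 * cb q1)) * x\<^sup>2
      + 2 * (ca q1 * c - a * cc q1) * x * y + (2 * cb q1 * c - 2 * b * cc q1) * y\<^sup>2"
    by (simp add: Jac_eq jac_coeff_defs defs algebra_simps)
  also have "\<dots> = k * j"
    unfolding q1 j_def by (simp add: algebra_simps)
  finally have J: "j = 2 / k * Jac q1 q2 w" using k by (simp add: field_simps)
  have "(a * p1 * x + b * (p1 * y + p2 * x) + c * p2 * y)\<^sup>2 * (a * r1\<^sup>2 + 2 * b * r1 * r2 + c * r2\<^sup>2)
      - (a * r1 * x + b * (r1 * y + r2 * x) + c * r2 * y)\<^sup>2 * (a * p1\<^sup>2 + 2 * b * p1 * p2 + c * p2\<^sup>2)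
      = (p1 * r2 - p2 * r1) * (a * c - b\<^sup>2) * j"
    unfolding j_def by (simp add: power2_eq_square algebra_simps)
  then have "(bilin (qmat q2) u1 w)\<^sup>2 * qf q2 u2 - (bilin (qmat q2) u2 w)\<^sup>2 * qf q2 u1
      = (p1 * r2 - p2 * r1) * (a * c - b\<^sup>2) * (2 / k) * Jac q1 q2 w"
    unfolding J by (simp add: bilin_qmat qf_def defs mult.assoc)
  then show ?thesis by (rule that)
qed

lemma Jac_root_bisects:
  fixes u1 u2 w :: "real ^ 2"
  assumes pd: "pos_def q2" and u: "roots_of (qf q1) u1 u2" and w: "w \<noteq> 0" and J: "Jac q1 q2 w = 0"
  shows "bisects (qmat q2) w u1 u2"
proof -
  let ?B = "bilin (qmat q2)"
  have p: "0 < ?B v v" if "v \<noteq> 0" for v :: "real ^ 2"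
    using pd that by (simp add: pos_def_def qf_eq_bilin)
  have pu: "0 < ?B u1 u1" "0 < ?B u2 u2" using p roots_of_nonzero[OF u] by auto
  have "(?B u1 w)\<^sup>2 * ?B u2 u2 = (?B u2 w)\<^sup>2 * ?B u1 u1"
    using bisector_identity[OF u, of q2 w] J by (auto simp: qf_eq_bilin)
  then have "sqrt ((?B u1 w)\<^sup>2 * ?B u2 u2) = sqrt ((?B u2 w)\<^sup>2 * ?B u1 u1)" by simp
  then have "\<bar>?B u1 w\<bar> * sqrt (?B u2 u2) = \<bar>?B u2 w\<bar> * sqrt (?B u1 u1)"
    by (simp add: real_sqrt_mult)
  moreover have "?B w u2 = ?B u2 w" by (simp add: bilin_qmat algebra_simps)
  ultimately have "\<bar>?B u1 w\<bar> / (sqrt (?B u1 u1) * sqrt (?B w w))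
      = \<bar>?B w u2\<bar> / (sqrt (?B w w) * sqrt (?B u2 u2))"
    using pu p[OF w] by (simp add: field_simps)
  then show ?thesis using pu p[OF w] by (simp add: bisects_def angle_wrt_def)
qed

text \<open>Two conjugate vectors of positive length form an orthogonal basis, in which \<open>q\<close> is a
  positive combination of squares.\<close>

lemma conjugate_pair_imp_pos_def:
  fixes w1 w2 :: "real ^ 2"
  assumes p: "0 < bilin (qmat q) w1 w1" "0 < bilin (qmat q) w2 w2"
    and o: "bilin (qmat q) w1 w2 = 0"
  shows "pos_def q"
  unfolding pos_def_def
proof (intro allI impI)
  fix v :: "real ^ 2" assume v: "v \<noteq> 0"
  let ?B = "bilin (qmat q)"
  define D where "D = w1 $ 1 * w2 $ 2 - w1 $ 2 * w2 $ 1"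
  define x where "x = v $ 1 * w2 $ 2 - v $ 2 * w2 $ 1"
  define y where "y = w1 $ 1 * v $ 2 - w1 $ 2 * v $ 1"
  \<comment> \<open>The Gram determinant of \<open>w1, w2\<close>, diagonal by conjugacy: it shows that they are independent.\<close>
  have gram: "?B w1 w1 * ?B w2 w2 = (ca q * cc q - (cb q)\<^sup>2) * D\<^sup>2"
    using o unfolding bilin_qmat D_def by simp algebra
  then have D: "D \<noteq> 0" using mult_pos_pos[OF p] by auto
  have cramer: "D * v $ 1 = x * w1 $ 1 + y * w2 $ 1" "D * v $ 2 = x * w1 $ 2 + y * w2 $ 2"
    by (simp_all add: D_def x_def y_def algebra_simps)
  have "D\<^sup>2 * qf q v = x\<^sup>2 * ?B w1 w1 + y\<^sup>2 * ?B w2 w2 + 2 * x * y * ?B w1 w2"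
  proof -
    have "D\<^sup>2 * qf q v = ca q * (D * v $ 1)\<^sup>2 + 2 * cb q * (D * v $ 1) * (D * v $ 2)
        + cc q * (D * v $ 2)\<^sup>2"
      by (simp add: qf_def power2_eq_square algebra_simps)
    then show ?thesis unfolding cramer by (simp add: bilin_qmat power2_eq_square algebra_simps)
  qed
  also have "\<dots> = x\<^sup>2 * ?B w1 w1 + y\<^sup>2 * ?B w2 w2" by (simp add: o)
  also have "0 < \<dots>"
  proof -
    have "x \<noteq> 0 \<or> y \<noteq> 0" using cramer v D by (auto simp: vec2_eq_0_iff)
    then show ?thesis using p
      by (elim disjE) (simp_all add: add_pos_nonneg add_nonneg_pos)
  qed
  finally show "0 < qf q v" using D by (simp add: zero_less_mult_iff)
qed

text \<open>If the Jacobian were zero, \<open>q\<^sub>1\<close> would be a multiple of the definite form \<open>q\<^sub>2\<close>, and only the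
  zero multiple has a real root.\<close>

lemma Jac_nonzero_if_pos_def_and_real_root:
  fixes u1 u2 :: "real ^ 2"
  assumes pd: "pos_def q2" and u: "roots_of (qf q1) u1 u2"
  shows "\<exists>v :: real ^ 2. Jac q1 q2 v \<noteq> 0"
proof (rule ccontr)
  assume "\<not> ?thesis"
  then have z: "jac20 q1 q2 = 0" "jac11 q1 q2 = 0" "jac02 q1 q2 = 0"
    unfolding Jac_nonzero_iff by auto
  have nz: "u1 \<noteq> 0" "u2 \<noteq> 0" using roots_of_nonzero[OF u] by auto
  have q: "qf q1 u1 = 0" using roots_of_vanish[OF u] by simp
  have "ca q2 * qf q1 u1 = ca q1 * qf q2 u1"
    using z by (simp add: qf_def jac_coeff_defs) algebra
  moreover have "0 < qf q2 u1" using pd nz by (simp add: pos_def_def)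
  ultimately have a: "ca q1 = 0" using q by auto
  with z pos_def_imp(1)[OF pd] have bc: "cb q1 = 0" "cc q1 = 0"
    by (auto simp: jac_coeff_defs)
  obtain k where "k \<noteq> 0" "0 = k * u1 $ 2 * u2 $ 2"
    "0 = - k * (u1 $ 1 * u2 $ 2 + u1 $ 2 * u2 $ 1)" "0 = k * u1 $ 1 * u2 $ 1"
    using roots_of_coeffs[OF u, of 0 0 0] a bc by (auto simp: qf_def)
  with nz show False by (auto simp: vec2_eq_0_iff)
qed

theorem theorem3p1:
  fixes q1 q2 :: bqf
  shows
    "\<comment> \<open>(1)\<close>
     (\<forall>w :: real ^ 2. local_extremal q1 q2 w \<longleftrightarrow> qf q1 w \<noteq> 0 \<and> Jac q1 q2 w = 0) \<and>
     (\<forall>w :: complex ^ 2. stationary q1 q2 w \<longleftrightarrow> qf q1 w \<noteq> 0 \<and> Jac q1 q2 w = 0) \<and>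
     ((\<exists>v :: real ^ 2. Jac q1 q2 v \<noteq> 0) \<longrightarrow>
        (\<exists>w1 w2 :: complex ^ 2. roots_of (Jac q1 q2) w1 w2)) \<and>
     (\<not> common_root q1 q2 \<and> det (qmat q1 :: real ^ 2 ^ 2) \<noteq> 0 \<longrightarrow>
        (\<exists>w1 w2 :: complex ^ 2. roots_of (Jac q1 q2) w1 w2 \<and> \<not> same_direction w1 w2 \<and>
           (\<forall>w. stationary q1 q2 w \<longleftrightarrow> same_direction w w1 \<or> same_direction w w2)) \<and>
        (\<forall>w1 w2 :: real ^ 2. roots_of (Jac q1 q2) w1 w2 \<longrightarrow> \<not> same_direction w1 w2 \<and>
           (\<forall>w. local_extremal q1 q2 w \<longleftrightarrow> same_direction w w1 \<or> same_direction w w2))) \<and>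
     (pos_def q1 \<longrightarrow>
        (\<forall>w :: real ^ 2. w \<noteq> 0 \<longrightarrow>
           (Jac q1 q2 w = 0 \<longleftrightarrow> global_min q1 q2 w \<or> global_max q1 q2 w)) \<and>
        ((\<exists>v :: real ^ 2. Jac q1 q2 v \<noteq> 0) \<longrightarrow>
           (\<exists>w1 w2 :: real ^ 2. roots_of (Jac q1 q2) w1 w2 \<and> \<not> same_direction w1 w2 \<and>
              global_min q1 q2 w1 \<and> global_max q1 q2 w2))) \<and>
     (\<forall>\<alpha> \<beta> :: real.
        det (vector
          [vector [deriv (\<lambda>x. qf q1 (vector [x, \<beta>])) \<alpha>, deriv (\<lambda>y. qf q1 (vector [\<alpha>, y])) \<beta>],
           vector [deriv (\<lambda>x. qf q2 (vector [x, \<beta>])) \<alpha>, deriv (\<lambda>y. qf q2 (vector [\<alpha>, y])) \<beta>]]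
          :: real ^ 2 ^ 2) = 4 * Jac q1 q2 (vector [\<alpha>, \<beta>])) \<and>
     (\<forall>w1 w2 :: complex ^ 2. roots_of (Jac q1 q2) w1 w2 \<longrightarrow>
        (same_direction w1 w2 \<longleftrightarrow> common_root q1 q2)) \<and>
     \<comment> \<open>(2)\<close>
     (\<forall>w :: complex ^ 2. qf q1 w = bilin (qmat q1) w w \<and> qf q2 w = bilin (qmat q2) w w) \<and>
     (\<forall>(w :: complex ^ 2) \<mu>. w \<noteq> 0 \<and> qmat q2 *v w = \<mu> *s (qmat q1 *v w) \<longrightarrow> Jac q1 q2 w = 0) \<and>
     (\<forall>w :: complex ^ 2. qmat q1 *v w \<noteq> 0 \<and> Jac q1 q2 w = 0 \<longrightarrow>
        (\<exists>!\<mu>. qmat q2 *v w = \<mu> *s (qmat q1 *v w))) \<and>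
     (pos_def_matrix (qmat q1) \<or> neg_def_matrix (qmat q1) \<longrightarrow>
        (\<forall>(w :: complex ^ 2) \<mu>. w \<noteq> 0 \<and> qmat q2 *v w = \<mu> *s (qmat q1 *v w) \<longrightarrow> \<mu> \<in> \<real>)) \<and>
     \<comment> \<open>(3)\<close>
     (\<forall>w1 w2 :: complex ^ 2. roots_of (Jac q1 q2) w1 w2 \<longrightarrow> orthogonal_wrt (qmat q2) w1 w2) \<and>
     (\<forall>u1 u2 :: real ^ 2. roots_of (qf q1) u1 u2 \<longrightarrow>
        (pos_def q2 \<longrightarrow> (\<exists>w1 w2 :: real ^ 2. roots_of (Jac q1 q2) w1 w2)) \<and>
        (\<forall>w1 w2 :: real ^ 2. roots_of (Jac q1 q2) w1 w2 \<longrightarrow>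
           (bisects (qmat q2) w1 u1 u2 \<and> bisects (qmat q2) w2 u1 u2 \<longleftrightarrow> pos_def q2)))"
proof (intro conjI)
  show "\<forall>w :: real ^ 2. local_extremal q1 q2 w \<longleftrightarrow> qf q1 w \<noteq> 0 \<and> Jac q1 q2 w = 0"
    using local_extremal_iff_Jac by blast
  show "\<forall>w :: complex ^ 2. stationary q1 q2 w \<longleftrightarrow> qf q1 w \<noteq> 0 \<and> Jac q1 q2 w = 0"
    using stationary_iff_Jac by blast
  show "(\<exists>v :: real ^ 2. Jac q1 q2 v \<noteq> 0) \<longrightarrow>
      (\<exists>w1 w2 :: complex ^ 2. roots_of (Jac q1 q2) w1 w2)"
    using Jac_complex_roots by blast
  show "\<not> common_root q1 q2 \<and> det (qmat q1 :: real ^ 2 ^ 2) \<noteq> 0 \<longrightarrow>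
        (\<exists>w1 w2 :: complex ^ 2. roots_of (Jac q1 q2) w1 w2 \<and> \<not> same_direction w1 w2 \<and>
           (\<forall>w. stationary q1 q2 w \<longleftrightarrow> same_direction w w1 \<or> same_direction w w2)) \<and>
        (\<forall>w1 w2 :: real ^ 2. roots_of (Jac q1 q2) w1 w2 \<longrightarrow> \<not> same_direction w1 w2 \<and>
           (\<forall>w. local_extremal q1 q2 w \<longleftrightarrow> same_direction w w1 \<or> same_direction w w2))"
  proof (intro impI conjI)
    assume "\<not> common_root q1 q2 \<and> det (qmat q1 :: real ^ 2 ^ 2) \<noteq> 0"
    then have nc: "\<not> common_root q1 q2" and det: "det (qmat q1 :: real ^ 2 ^ 2) \<noteq> 0" by auto
    have ncr: "qf q2 v \<noteq> 0" if "v \<noteq> 0" "qf q1 v = 0" for v :: "real ^ 2"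
      using real_common_root nc that by blast
    have ncc: "qf q2 v \<noteq> 0" if "v \<noteq> 0" "qf q1 v = 0" for v :: "complex ^ 2"
      using nc that by (auto simp: common_root_def)
    obtain w1 w2 :: "complex ^ 2" where r: "roots_of (Jac q1 q2) w1 w2"
      using Jac_complex_roots[OF Jac_nonzero_if_no_common_root[OF nc]] by blast
    moreover have "\<not> same_direction w1 w2"
      using double_Jac_root_is_common_root[OF r] ncc roots_of_nonzero[OF r] by blast
    moreover have "stationary q1 q2 w \<longleftrightarrow> same_direction w w1 \<or> same_direction w w2" for w
      using critical_iff_Jac_root[OF r det ncc] unfolding stationary_iff_Jac by blast
    ultimately show "\<exists>w1 w2 :: complex ^ 2. roots_of (Jac q1 q2) w1 w2 \<and> \<not> same_direction w1 w2 \<and>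
        (\<forall>w. stationary q1 q2 w \<longleftrightarrow> same_direction w w1 \<or> same_direction w w2)" by blast
    show "\<forall>w1 w2 :: real ^ 2. roots_of (Jac q1 q2) w1 w2 \<longrightarrow> \<not> same_direction w1 w2 \<and>
        (\<forall>w. local_extremal q1 q2 w \<longleftrightarrow> same_direction w w1 \<or> same_direction w w2)"
    proof (intro allI impI)
      fix w1 w2 :: "real ^ 2"
      assume r: "roots_of (Jac q1 q2) w1 w2"
      have "\<not> same_direction w1 w2"
        using double_Jac_root_is_common_root[OF r] ncr roots_of_nonzero[OF r] by blast
      moreover have "local_extremal q1 q2 w \<longleftrightarrow> same_direction w w1 \<or> same_direction w w2" for w
        using critical_iff_Jac_root[OF r det ncr] unfolding local_extremal_iff_Jac by blast
      ultimately show "\<not> same_direction w1 w2 \<and>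
        (\<forall>w. local_extremal q1 q2 w \<longleftrightarrow> same_direction w w1 \<or> same_direction w w2)" by blast
    qed
  qed
  show "pos_def q1 \<longrightarrow>
        (\<forall>w :: real ^ 2. w \<noteq> 0 \<longrightarrow>
           (Jac q1 q2 w = 0 \<longleftrightarrow> global_min q1 q2 w \<or> global_max q1 q2 w)) \<and>
        ((\<exists>v :: real ^ 2. Jac q1 q2 v \<noteq> 0) \<longrightarrow>
           (\<exists>w1 w2 :: real ^ 2. roots_of (Jac q1 q2) w1 w2 \<and> \<not> same_direction w1 w2 \<and>
              global_min q1 q2 w1 \<and> global_max q1 q2 w2))"
    using Jac_0_imp_global_extremum global_extremum_imp_Jac_0 global_min_max_roots by blast
  show "\<forall>\<alpha> \<beta> :: real.
        det (vector
          [vector [deriv (\<lambda>x. qf q1 (vector [x, \<beta>])) \<alpha>, deriv (\<lambda>y. qf q1 (vector [\<alpha>, y])) \<beta>],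
           vector [deriv (\<lambda>x. qf q2 (vector [x, \<beta>])) \<alpha>, deriv (\<lambda>y. qf q2 (vector [\<alpha>, y])) \<beta>]]
          :: real ^ 2 ^ 2) = 4 * Jac q1 q2 (vector [\<alpha>, \<beta>])"
    using gradient_det by blast
  show "\<forall>w1 w2 :: complex ^ 2. roots_of (Jac q1 q2) w1 w2 \<longrightarrow>
        (same_direction w1 w2 \<longleftrightarrow> common_root q1 q2)"
    unfolding common_root_def
    using double_Jac_root_is_common_root common_root_imp_double_Jac_root roots_of_nonzero by metis
  show "\<forall>w :: complex ^ 2. qf q1 w = bilin (qmat q1) w w \<and> qf q2 w = bilin (qmat q2) w w"
    using qf_eq_bilin by blast
  show "\<forall>(w :: complex ^ 2) \<mu>. w \<noteq> 0 \<and> qmat q2 *v w = \<mu> *s (qmat q1 *v w) \<longrightarrow> Jac q1 q2 w = 0"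
    using eigenvector_imp_Jac_0 by blast
  show "\<forall>w :: complex ^ 2. qmat q1 *v w \<noteq> 0 \<and> Jac q1 q2 w = 0 \<longrightarrow>
        (\<exists>!\<mu>. qmat q2 *v w = \<mu> *s (qmat q1 *v w))"
    using Jac_0_imp_eigenvector by blast
  show "pos_def_matrix (qmat q1) \<or> neg_def_matrix (qmat q1) \<longrightarrow>
        (\<forall>(w :: complex ^ 2) \<mu>. w \<noteq> 0 \<and> qmat q2 *v w = \<mu> *s (qmat q1 *v w) \<longrightarrow> \<mu> \<in> \<real>)"
    using eigenvalue_real by blast
  show "\<forall>w1 w2 :: complex ^ 2. roots_of (Jac q1 q2) w1 w2 \<longrightarrow> orthogonal_wrt (qmat q2) w1 w2"
    using Jac_roots_conjugate(2) unfolding orthogonal_wrt_def by blast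
  show "\<forall>u1 u2 :: real ^ 2. roots_of (qf q1) u1 u2 \<longrightarrow>
        (pos_def q2 \<longrightarrow> (\<exists>w1 w2 :: real ^ 2. roots_of (Jac q1 q2) w1 w2)) \<and>
        (\<forall>w1 w2 :: real ^ 2. roots_of (Jac q1 q2) w1 w2 \<longrightarrow>
           (bisects (qmat q2) w1 u1 u2 \<and> bisects (qmat q2) w2 u1 u2 \<longleftrightarrow> pos_def q2))"
  proof (intro allI impI conjI)
    fix u1 u2 :: "real ^ 2"
    assume u: "roots_of (qf q1) u1 u2"
    show "\<exists>w1 w2 :: real ^ 2. roots_of (Jac q1 q2) w1 w2" if "pos_def q2"
      using Jac_real_roots Jac_nonzero_if_pos_def_and_real_root[OF that u] that by blast
    fix w1 w2 :: "real ^ 2"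
    assume r: "roots_of (Jac q1 q2) w1 w2"
    show "bisects (qmat q2) w1 u1 u2 \<and> bisects (qmat q2) w2 u1 u2 \<longleftrightarrow> pos_def q2"
    proof
      assume "bisects (qmat q2) w1 u1 u2 \<and> bisects (qmat q2) w2 u1 u2"
      then show "pos_def q2"
        using conjugate_pair_imp_pos_def Jac_roots_conjugate(2)[OF r] unfolding bisects_def by blast
    next
      assume "pos_def q2"
      then show "bisects (qmat q2) w1 u1 u2 \<and> bisects (qmat q2) w2 u1 u2"
        using Jac_root_bisects[OF _ u] roots_of_nonzero[OF r] roots_of_vanish[OF r] by blast
    qed
  qed
qed

end
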